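(* Let $\mathcal{G}$ and $\mathcal{G}'$ be any pair of dags (over the same finite node set) such that $\mathcal{G}\approx\mathcal{G}'$. Then there exists a sequence of $|\Delta(\mathcal{G},\mathcal{G}')|$ distinct edge reversals, performed successively in $\mathcal{G}$, with the following properties: (1) each edge reversed is a covered edge in the current graph $\mathcal{G}$ at the moment it is reversed; (2) after each reversal, the current graph $\mathcal{G}$ is a dag and $\mathcal{G}\approx\mathcal{G}'$; (3) after all reversals, $\mathcal{G}=\mathcal{G}'$.
   Context: All graphs have the same finite vertex set $U=\{x_1,\dots,x_n\}$; a dag $\mathcal{G}=(U,E_{\mathcal{G}})$ is an acyclic directed graph. Each node $x_i$ is a discrete variable with a finite number $r_i\ge 2$ of states. $\Pi_x^{\mathcal{G}}$ denotes the set of parents of $x$ in $\mathcal{G}$. A Bayesian network with structure $\mathcal{G}$ is a pair $(\mathcal{G},\theta_{\mathcal{G}})$ where $\theta_{\mathcal{G}}$ is a collection of conditional distributions $p(x_i\mid\Pi_{x_i}^{\mathcal{G}})$; it defines the joint distribution $\prod_i p(x_i\mid\Pi_{x_i}^{\mathcal{G}})$. Two dags are equivalent, written $\mathcal{G}\approx\mathcal{G}'$, if for every Bayesian network $(\mathcal{G},\theta_{\mathcal{G}})$ there is a Bayesian network $(\mathcal{G}',\theta_{\mathcal{G}'})$ defining the same joint distribution, and vice versa. The skeleton of a dag is the undirected graph obtained by ignoring edge directions. A v-structure in $\mathcal{G}$ is an ordered triple $(x,y,z)$ of distinct nodes with $x\to y$, $z\to y$ in $\mathcal{G}$ and $x,z$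 not adjacent. Known fact (Verma and Pearl): $\mathcal{G}\approx\mathcal{G}'$ if and only if they have the same skeleton and the same v-structures. For dags with the same skeleton, $\Delta(\mathcal{G},\mathcal{G}')$ is the set of edges of $\mathcal{G}$ that have the opposite orientation in $\mathcal{G}'$. An edge $x\to y\in E_{\mathcal{G}}$ is covered in $\mathcal{G}$ if $\Pi_y^{\mathcal{G}}=\Pi_x^{\mathcal{G}}\cup\{x\}$. *)

theory Defs
  imports Complex_Main "HOL-Library.FuncSet"
begin

text \<open>Directed graphs on a common vertex set \<open>U\<close> are identified with their edge sets;
  the pair \<open>(x, y)\<close> is the edge \<open>x \<rightarrow> y\<close>.\<close>

definition dag :: "'a set \<Rightarrow> ('a \<times> 'a) set \<Rightarrow> bool" where
  "dag U G \<longleftrightarrow> G \<subseteq> U \<times> U \<and> acyclic G"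

definition parents :: "('a \<times> 'a) set \<Rightarrow> 'a \<Rightarrow> 'a set" where
  "parents G y = {x. (x, y) \<in> G}"

text \<open>Joint states of the variables in \<open>A\<close>, where variable \<open>x\<close> has the \<open>r x\<close> states
  \<open>0, \<dots>, r x - 1\<close>.\<close>

definition configs :: "('a \<Rightarrow> nat) \<Rightarrow> 'a set \<Rightarrow> ('a \<Rightarrow> nat) set" where
  "configs r A = (\<Pi>\<^sub>E x\<in>A. {..<r x})"

text \<open>\<open>\<theta> x c k\<close> is the conditional probability that \<open>x\<close> is in state \<open>k\<close> given that its parents
  are in the joint state \<open>c\<close>. Probabilities equal to zero are permitted.\<close>

definition bayesian_network ::
    "'a set \<Rightarrow> ('a \<Rightarrow> nat) \<Rightarrow> ('a \<times> 'a) set \<Rightarrow> ('a \<Rightarrow> ('a \<Rightarrow> nat) \<Rightarrow> nat \<Rightarrow> real) \<Rightarrow> bool" where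
  "bayesian_network U r G \<theta> \<longleftrightarrow> dag U G \<and>
     (\<forall>x\<in>U. \<forall>c\<in>configs r (parents G x).
        (\<forall>k<r x. 0 \<le> \<theta> x c k) \<and> (\<Sum>k<r x. \<theta> x c k) = 1)"

definition joint ::
    "'a set \<Rightarrow> ('a \<times> 'a) set \<Rightarrow> ('a \<Rightarrow> ('a \<Rightarrow> nat) \<Rightarrow> nat \<Rightarrow> real) \<Rightarrow> ('a \<Rightarrow> nat) \<Rightarrow> real" where
  "joint U G \<theta> s = (\<Prod>x\<in>U. \<theta> x (restrict s (parents G x)) (s x))"

definition represents ::
    "'a set \<Rightarrow> ('a \<Rightarrow> nat) \<Rightarrow> ('a \<times> 'a) set \<Rightarrow> ('a \<times> 'a) set \<Rightarrow> bool" where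
  "represents U r G' G \<longleftrightarrow>
     (\<forall>\<theta>. bayesian_network U r G \<theta> \<longrightarrow>
        (\<exists>\<theta>'. bayesian_network U r G' \<theta>' \<and>
           (\<forall>s\<in>configs r U. joint U G' \<theta>' s = joint U G \<theta> s)))"

definition equivalent ::
    "'a set \<Rightarrow> ('a \<Rightarrow> nat) \<Rightarrow> ('a \<times> 'a) set \<Rightarrow> ('a \<times> 'a) set \<Rightarrow> bool" where
  "equivalent U r G G' \<longleftrightarrow> represents U r G' G \<and> represents U r G G'"

definition Delta :: "('a \<times> 'a) set \<Rightarrow> ('a \<times> 'a) set \<Rightarrow> ('a \<times> 'a) set" where
  "Delta G G' = {(x, y). (x, y) \<in> G \<and> (y, x) \<in> G'}"

definition covered :: "('a \<times> 'a) set \<Rightarrow> 'a \<times> 'a \<Rightarrow> bool" where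
  "covered G e \<longleftrightarrow> (case e of (x, y) \<Rightarrow> (x, y) \<in> G \<and> parents G y = parents G x \<union> {x})"

definition reverse_edge :: "'a \<times> 'a \<Rightarrow> ('a \<times> 'a) set \<Rightarrow> ('a \<times> 'a) set" where
  "reverse_edge e G = (case e of (x, y) \<Rightarrow> (G - {(x, y)}) \<union> {(y, x)})"

text \<open>The graph after the first \<open>i\<close> reversals of the sequence \<open>es\<close>. Each entry of \<open>es\<close> is an
  edge with the orientation it has just before it is reversed.\<close>

definition after_reversals :: "('a \<times> 'a) list \<Rightarrow> nat \<Rightarrow> ('a \<times> 'a) set \<Rightarrow> ('a \<times> 'a) set" where
  "after_reversals es i G = fold reverse_edge (take i es) G"

text \<open>Distinctness is up to orientation: reversing \<open>x \<rightarrow> y\<close> and later \<open>y \<rightarrow> x\<close> counts as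
  reversing the same edge twice.\<close>

definition distinct_edges :: "('a \<times> 'a) list \<Rightarrow> bool" where
  "distinct_edges es \<longleftrightarrow> distinct (map (\<lambda>(x, y). {x, y}) es)"

end

theory Submission
  imports Defs
begin

text \<open>The sequence is built by induction on \<open>card (Delta G G')\<close>. Take the node \<open>y\<close> that is
  minimal in \<open>G\<close> among the heads of edges in \<open>Delta G G'\<close>, and among the edges of \<open>Delta G G'\<close>
  into \<open>y\<close> the one whose tail \<open>x\<close> is maximal; equality of skeletons and v-structures forces
  \<open>x \<rightarrow> y\<close> to be covered. Reversing a covered edge preserves equivalence by Bayes' rule, and it
  removes exactly this edge from \<open>Delta G G'\<close>.

  That equivalent dags have the same skeleton and v-structures is proved with supports only: in
  the support of a Bayesian network, the state of \<open>x\<close> can be exchanged without changing the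
  nondescendants of \<open>x\<close>, provided that the parents of \<open>x\<close> agree. The distributions that make \<open>y\<close>
  a copy of \<open>x\<close>, respectively the exclusive or of \<open>x\<close> and \<open>z\<close>, violate this for
  dags that lack the edge, respectively the v-structure.\<close>

section \<open>Supports of Bayesian networks\<close>

lemma parents_subset: "dag U G \<Longrightarrow> parents G x \<subseteq> U"
  by (auto simp: dag_def parents_def)

lemma dag_trancl_irrefl: "dag U G \<Longrightarrow> (x, x) \<notin> G\<^sup>+"
  by (simp add: dag_def acyclic_def)

lemma dag_finite: "finite U \<Longrightarrow> dag U G \<Longrightarrow> finite G"
  by (auto simp: dag_def intro: finite_subset[OF _ finite_cartesian_product])

lemma dag_wf: "finite U \<Longrightarrow> dag U G \<Longrightarrow> wf (G\<^sup>+)"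
  by (metis dag_def dag_finite finite_acyclic_wf wf_trancl)

lemma dag_wf_converse: "finite U \<Longrightarrow> dag U G \<Longrightarrow> wf ((G\<^sup>+)\<inverse>)"
  by (auto simp: dag_def simp flip: trancl_converse
      intro!: wf_trancl finite_acyclic_wf_converse intro: dag_finite)

lemma restrict_configs: "s \<in> configs r U \<Longrightarrow> A \<subseteq> U \<Longrightarrow> restrict s A \<in> configs r A"
  by (auto simp: configs_def)

lemma configs_less: "s \<in> configs r U \<Longrightarrow> x \<in> U \<Longrightarrow> s x < r x"
  by (auto simp: configs_def)

lemma joint_pos_iff:
  assumes "finite U" "bayesian_network U r G \<theta>" "s \<in> configs r U"
  shows "0 < joint U G \<theta> s \<longleftrightarrow> (\<forall>x\<in>U. 0 < \<theta> x (restrict s (parents G x)) (s x))"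
proof -
  have "0 \<le> \<theta> x (restrict s (parents G x)) (s x)" if "x \<in> U" for x
    using assms that restrict_configs[OF assms(3) parents_subset] configs_less[OF assms(3) that]
    by (simp add: bayesian_network_def)
  then show ?thesis
    unfolding joint_def using assms(1)
    by (fastforce simp: less_le prod_nonneg intro: prod_pos)
qed

lemma bayesian_network_state_pos:
  assumes "bayesian_network U r G \<theta>" "x \<in> U" "c \<in> configs r (parents G x)"
  shows "\<exists>k<r x. 0 < \<theta> x c k"
proof (rule ccontr)
  assume "\<not> ?thesis"
  then have "(\<Sum>k<r x. \<theta> x c k) \<le> 0"
    by (intro sum_nonpos) force
  with assms show False by (force simp: bayesian_network_def)
qed

text \<open>Since \<open>A\<close> is closed under parents, \<open>t\<close> can be extended one
  vertex at a time. A vertex outside \<open>A\<close> with no ancestor outside \<open>A\<close> has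
  all its parents in \<open>A\<close>, and some state of it has positive conditional probability;
  the factors at the vertices of \<open>A\<close> do not change.\<close>

lemma extend_to_support:
  assumes "finite U" and bn: "bayesian_network U r G \<theta>"
    and "A \<subseteq> U" and "\<And>x. x \<in> A \<Longrightarrow> parents G x \<subseteq> A"
    and "t \<in> configs r A"
    and "\<And>x. x \<in> A \<Longrightarrow> 0 < \<theta> x (restrict t (parents G x)) (t x)"
  shows "\<exists>w\<in>configs r U. 0 < joint U G \<theta> w \<and> (\<forall>x\<in>A. w x = t x)"
  using assms(3-)
proof (induction "card (U - A)" arbitrary: A t rule: less_induct)
  case less
  have dag: "dag U G" using bn by (simp add: bayesian_network_def)
  show ?case
  proof (cases "A = U")
    case True
    with less.prems joint_pos_iff[OF \<open>finite U\<close> bn] show ?thesis by blast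
  next
    case False
    with less.prems(1) obtain v where "v \<in> U - A" by blast
    with wfE_min[OF dag_wf[OF \<open>finite U\<close> dag]]
    obtain v where v: "v \<in> U - A" and min: "\<And>u. (u, v) \<in> G\<^sup>+ \<Longrightarrow> u \<notin> U - A"
      by metis
    have pv: "parents G v \<subseteq> A"
      using min parents_subset[OF dag, of v] by (auto simp: parents_def)
    with less.prems(3) obtain k where k: "k < r v" "0 < \<theta> v (restrict t (parents G v)) k"
      using bayesian_network_state_pos[OF bn] restrict_configs v by (metis DiffD1)
    have upd: "restrict (t(v := k)) B = restrict t B" if "B \<subseteq> A" for B
      using that v by (auto simp: restrict_def fun_eq_iff)
    have 1: "card (U - insert v A) < card (U - A)"
      using \<open>finite U\<close> v by (intro psubset_card_mono) auto
    have 2: "t(v := k) \<in> configs r (insert v A)"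
      using less.prems(3) k(1) by (auto simp: configs_def PiE_def extensional_def)
    have 3: "0 < \<theta> x (restrict (t(v := k)) (parents G x)) ((t(v := k)) x)"
      if "x \<in> insert v A" for x
      using that k(2) less.prems(2,4) pv v upd by fastforce
    obtain w where w: "w \<in> configs r U" "0 < joint U G \<theta> w"
        "\<forall>x\<in>insert v A. w x = (t(v := k)) x"
      using less.hyps[OF 1 _ _ 2 3] less.prems(1,2) pv v by (metis Diff_iff insert_iff insert_subset subset_insertI2)
    moreover have "\<forall>x\<in>A. w x = t x" using w(3) v by (auto split: if_splits)
    ultimately show ?thesis by blast
  qed
qed

text \<open>The nondescendants of \<open>x\<close> are closed under parents and contain the parents
  of \<open>x\<close>. So the state of \<open>x\<close> in \<open>s\<close> can be combined with the
  states of \<open>t\<close> at the nondescendants, every factor staying positive. The descendants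
  are then filled in by \<open>extend_to_support\<close>.\<close>

lemma support_exchange:
  assumes "finite U" and bn: "bayesian_network U r G \<theta>" and x: "x \<in> U"
    and s: "s \<in> configs r U" "0 < joint U G \<theta> s"
    and t: "t \<in> configs r U" "0 < joint U G \<theta> t"
    and agree: "\<And>p. p \<in> parents G x \<Longrightarrow> s p = t p"
  shows "\<exists>w\<in>configs r U. 0 < joint U G \<theta> w \<and> w x = s x \<and>
    (\<forall>v\<in>U. v \<noteq> x \<and> (x, v) \<notin> G\<^sup>+ \<longrightarrow> w v = t v)"
proof -
  have dag: "dag U G" using bn by (simp add: bayesian_network_def)
  define N where "N = {v\<in>U. v \<noteq> x \<and> (x, v) \<notin> G\<^sup>+}"
  define u where "u = restrict (t(x := s x)) (insert x N)"
  have N: "parents G v \<subseteq> N" if "v \<in> N" for v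
    using that parents_subset[OF dag, of v]
    by (auto simp: N_def parents_def intro: trancl_into_trancl)
  have px: "parents G x \<subseteq> N"
    using parents_subset[OF dag, of x] dag_trancl_irrefl[OF dag, of x]
    by (auto simp: N_def parents_def intro: trancl_into_trancl)
  have xN: "x \<notin> N" "insert x N \<subseteq> U" using x by (auto simp: N_def)
  have u: "u \<in> configs r (insert x N)"
    using s(1) t(1) xN by (auto simp: u_def configs_def)
  have res: "restrict u B = restrict t B" if "B \<subseteq> N" for B
    using that xN(1) by (auto simp: u_def restrict_def fun_eq_iff)
  have "0 < \<theta> v (restrict u (parents G v)) (u v)" if "v \<in> insert x N" for v
  proof (cases "v = x")
    case True
    have "restrict u (parents G x) = restrict s (parents G x)"
      using res[OF px] agree by (auto simp: restrict_def fun_eq_iff)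
    with True s x joint_pos_iff[OF \<open>finite U\<close> bn] show ?thesis by (simp add: u_def)
  next
    case False
    with that res[OF N] have "restrict u (parents G v) = restrict t (parents G v)" "u v = t v"
      by (auto simp: u_def)
    with that False t xN joint_pos_iff[OF \<open>finite U\<close> bn] show ?thesis by auto
  qed
  with extend_to_support[OF \<open>finite U\<close> bn xN(2) _ u] N px
  obtain w where w: "w \<in> configs r U" "0 < joint U G \<theta> w" "\<forall>v\<in>insert x N. w v = u v"
    by (metis insertE subset_insertI2)
  have "w x = s x" using w(3) by (simp add: u_def)
  moreover have "\<forall>v\<in>N. w v = t v" using w(3) xN(1) by (auto simp: u_def)
  ultimately show ?thesis using w(1,2) by (auto simp: N_def)
qed

text \<open>Each conditional distribution is taken uniform on its prescribed set
  \<open>S x c\<close>. Supports can thus be designed combinatorially, without choosing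
  probabilities.\<close>

lemma bayesian_network_with_support:
  assumes "finite U" "dag U G"
    and S: "\<And>x c. x \<in> U \<Longrightarrow> S x c \<noteq> {} \<and> S x c \<subseteq> {..<r x}"
  shows "\<exists>\<theta>. bayesian_network U r G \<theta> \<and> (\<forall>s\<in>configs r U.
    0 < joint U G \<theta> s \<longleftrightarrow> (\<forall>x\<in>U. s x \<in> S x (restrict s (parents G x))))"
proof -
  define \<theta> :: "'a \<Rightarrow> ('a \<Rightarrow> nat) \<Rightarrow> nat \<Rightarrow> real"
    where "\<theta> = (\<lambda>x c k. if k \<in> S x c then 1 / card (S x c) else 0)"
  have card: "0 < card (S x c)" if "x \<in> U" for x c
    using S[OF that, of c] by (meson card_gt_0_iff finite_lessThan finite_subset)
  have sum: "(\<Sum>k<r x. \<theta> x c k) = 1" if "x \<in> U" for x c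
  proof -
    have "(\<Sum>k<r x. \<theta> x c k) = (\<Sum>k\<in>S x c. 1 / card (S x c))"
      unfolding \<theta>_def using S[OF that, of c]
      by (subst sum.inter_restrict[symmetric]) (auto simp: Int_absorb1)
    with card[OF that, of c] show ?thesis by simp
  qed
  have "bayesian_network U r G \<theta>"
    using assms(2) sum by (simp add: bayesian_network_def \<theta>_def)
  moreover have "0 < \<theta> x c k \<longleftrightarrow> k \<in> S x c" if "x \<in> U" for x c k
    using card[OF that] by (simp add: \<theta>_def)
  ultimately show ?thesis using joint_pos_iff[OF assms(1)] by metis
qed

text \<open>A network on \<open>G\<close> and the network on \<open>G'\<close> with the same joint
  distribution have the same support. An exchange governed by the parents in \<open>G'\<close> must
  therefore be possible inside a support designed along \<open>G\<close>; the contradictions below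
  come from designs that forbid it.\<close>

lemma represents_support_exchange:
  assumes "finite U" and "dag U G" and rep: "represents U r G' G"
    and S: "\<forall>x\<in>U. \<forall>c. S x c \<noteq> {} \<and> S x c \<subseteq> {..<r x}"
    and x: "x \<in> U"
    and s: "s \<in> configs r U" "\<forall>v\<in>U. s v \<in> S v (restrict s (parents G v))"
    and t: "t \<in> configs r U" "\<forall>v\<in>U. t v \<in> S v (restrict t (parents G v))"
    and agree: "\<forall>p\<in>parents G' x. s p = t p"
  shows "\<exists>w. (\<forall>v\<in>U. w v \<in> S v (restrict w (parents G v))) \<and> w x = s x \<and>
    (\<forall>v\<in>U. v \<noteq> x \<and> (x, v) \<notin> G'\<^sup>+ \<longrightarrow> w v = t v)"
proof -
  obtain \<theta> where \<theta>: "bayesian_network U r G \<theta>" and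
    supp: "\<And>s. s \<in> configs r U \<Longrightarrow>
      0 < joint U G \<theta> s \<longleftrightarrow> (\<forall>x\<in>U. s x \<in> S x (restrict s (parents G x)))"
    using bayesian_network_with_support[where S=S and r=r, OF assms(1,2)] S by metis
  with rep obtain \<theta>' where \<theta>': "bayesian_network U r G' \<theta>'"
    and eq: "\<And>s. s \<in> configs r U \<Longrightarrow> joint U G' \<theta>' s = joint U G \<theta> s"
    by (auto simp: represents_def)
  have "0 < joint U G' \<theta>' s" "0 < joint U G' \<theta>' t"
    using s t eq supp by auto
  from support_exchange[OF assms(1) \<theta>' x s(1) this(1) t(1) this(2)] agree
  show ?thesis using eq supp by metis
qed

section \<open>Skeletons and v-structures\<close>

text \<open>In a dag, \<open>y\<close> differs from \<open>x\<close> and \<open>z\<close> because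
  there are no loops, so only \<open>x \<noteq> z\<close> is demanded.\<close>

definition v_structure :: "('a \<times> 'a) set \<Rightarrow> 'a \<Rightarrow> 'a \<Rightarrow> 'a \<Rightarrow> bool" where
  "v_structure G x y z \<longleftrightarrow>
    x \<noteq> z \<and> (x, y) \<in> G \<and> (z, y) \<in> G \<and> (x, z) \<notin> G \<and> (z, x) \<notin> G"

text \<open>By acyclicity of \<open>G'\<close>, \<open>x\<close> and \<open>y\<close> cannot both be
  descendants of each other. If they are nonadjacent in \<open>G'\<close>, the state of one of them
  can thus be exchanged while the other keeps its state, and \<open>y\<close> is no longer a copy of
  \<open>x\<close>.\<close>

lemma represents_adjacent:
  assumes "finite U" and r: "\<forall>x\<in>U. r x \<ge> 2"
    and G: "dag U G" and G': "dag U G'" and rep: "represents U r G' G"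
    and xy: "(x, y) \<in> G"
  shows "(x, y) \<in> G' \<or> (y, x) \<in> G'"
proof (rule ccontr)
  assume nonadj: "\<not> ?thesis"
  have U: "x \<in> U" "y \<in> U" and "x \<noteq> y"
    using xy G dag_trancl_irrefl[OF G, of x] by (auto simp: dag_def)
  \<comment> \<open>All variables other than \<open>x\<close> and \<open>y\<close> are frozen at 0.
    Testing \<open>c x = 1\<close> instead of returning \<open>c x\<close> keeps the set within the
    states of \<open>y\<close> for every function \<open>c\<close>, as the bound on \<open>S\<close>
    is asked for all \<open>c\<close>.\<close>
  define S :: "'a \<Rightarrow> ('a \<Rightarrow> nat) \<Rightarrow> nat set" where
    "S = (\<lambda>v c. if v = x then {0, 1} else if v = y then {if c x = 1 then 1 else 0} else {0})"
  have S: "\<forall>v\<in>U. \<forall>c. S v c \<noteq> {} \<and> S v c \<subseteq> {..<r v}"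
    using r by (force simp: S_def)
  \<comment> \<open>The two states differ only at \<open>x\<close> and \<open>y\<close>, so
    nonadjacency in \<open>G'\<close> makes them agree on the parents of either node.\<close>
  define s where "s = (\<lambda>v\<in>U. if v = x \<or> v = y then 1 else 0 :: nat)"
  define t where "t = (\<lambda>v\<in>U. 0 :: nat)"
  have xp: "x \<in> parents G y" using xy by (simp add: parents_def)
  have s: "s \<in> configs r U" "\<forall>v\<in>U. s v \<in> S v (restrict s (parents G v))"
    and t: "t \<in> configs r U" "\<forall>v\<in>U. t v \<in> S v (restrict t (parents G v))"
    using r xp U by (fastforce simp: s_def t_def S_def configs_def)+
  have False if ab: "{a, b} = {x, y}" and nanc: "(a, b) \<notin> G'\<^sup>+" for a b
  proof -
    have "a \<in> U" "b \<in> U" "a \<noteq> b" using ab U \<open>x \<noteq> y\<close> by (auto simp: doubleton_eq_iff)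
    have "\<forall>p\<in>parents G' a. s p = t p"
      using nonadj ab parents_subset[OF G', of a] dag_trancl_irrefl[OF G', of a]
      by (auto simp: s_def t_def parents_def doubleton_eq_iff)
    from represents_support_exchange[OF \<open>finite U\<close> G rep S \<open>a \<in> U\<close> s t this]
    obtain w where w: "\<forall>v\<in>U. w v \<in> S v (restrict w (parents G v))"
      "w a = s a" "w b = t b"
      using nanc \<open>b \<in> U\<close> \<open>a \<noteq> b\<close> by metis
    have "w a = 1" "w b = 0"
      using w(2,3) ab U by (auto simp: s_def t_def doubleton_eq_iff)
    moreover have "w y = (if w x = 1 then 1 else 0)"
      using bspec[OF w(1) U(2)] \<open>x \<noteq> y\<close> xp by (simp add: S_def)
    ultimately show False using ab by (auto simp: doubleton_eq_iff)
  qed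
  from this[of x y] this[of y x] have "(x, y) \<in> G'\<^sup>+" "(y, x) \<in> G'\<^sup>+" by auto
  with dag_trancl_irrefl[OF G'] show False by (meson trancl_trans)
qed

text \<open>Both directions of the equivalence are used to carry over adjacency and nonadjacency, so
  if the v-structure is lost, \<open>y\<close> points to \<open>x\<close> or to \<open>z\<close> in
  \<open>G'\<close>. One of \<open>x\<close>, \<open>z\<close> can then be exchanged while the other
  and \<open>y\<close> stay fixed, which breaks the exclusive or.\<close>

lemma represents_v_structure:
  assumes "finite U" and r: "\<forall>x\<in>U. r x \<ge> 2"
    and G: "dag U G" and G': "dag U G'" and eq: "equivalent U r G G'"
    and v: "v_structure G x y z"
  shows "v_structure G' x y z"
proof (rule ccontr)
  assume not_v: "\<not> ?thesis"
  have rep: "represents U r G' G" "represents U r G G'"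
    using eq by (auto simp: equivalent_def)
  have xyz: "(x, y) \<in> G" "(z, y) \<in> G" "x \<noteq> z" "(x, z) \<notin> G" "(z, x) \<notin> G"
    using v by (auto simp: v_structure_def)
  have U: "x \<in> U" "y \<in> U" "z \<in> U" and ne: "x \<noteq> y" "z \<noteq> y"
    using xyz G dag_trancl_irrefl[OF G, of y] by (auto simp: dag_def)
  have nonadj: "(x, z) \<notin> G'" "(z, x) \<notin> G'"
    using represents_adjacent[OF \<open>finite U\<close> r G' G rep(2)] xyz by blast+
  have adj: "(x, y) \<in> G' \<or> (y, x) \<in> G'" "(z, y) \<in> G' \<or> (y, z) \<in> G'"
    using represents_adjacent[OF \<open>finite U\<close> r G G' rep(1)] xyz by blast+
  define S :: "'a \<Rightarrow> ('a \<Rightarrow> nat) \<Rightarrow> nat set" where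
    "S = (\<lambda>v c. if v = x \<or> v = z then {0, 1}
      else if v = y then {if c x = c z then 0 else 1} else {0})"
  have S: "\<forall>v\<in>U. \<forall>c. S v c \<noteq> {} \<and> S v c \<subseteq> {..<r v}"
    using r by (force simp: S_def)
  \<comment> \<open>With \<open>x\<close> and \<open>z\<close> both 1 the exclusive or is 0, so
    \<open>y\<close> has the same state in \<open>s\<close> and \<open>t\<close>. The two states
    therefore agree on the parents of \<open>x\<close> and of \<open>z\<close> even when
    \<open>y\<close> is among them.\<close>
  define s where "s = (\<lambda>v\<in>U. if v = x \<or> v = z then 1 else 0 :: nat)"
  define t where "t = (\<lambda>v\<in>U. 0 :: nat)"
  have p: "x \<in> parents G y" "z \<in> parents G y" using xyz by (auto simp: parents_def)
  have s: "s \<in> configs r U" "\<forall>v\<in>U. s v \<in> S v (restrict s (parents G v))"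
    and t: "t \<in> configs r U" "\<forall>v\<in>U. t v \<in> S v (restrict t (parents G v))"
    using r p U by (fastforce simp: s_def t_def S_def configs_def)+
  have False if ab: "{a, b} = {x, z}" and nanc: "(a, b) \<notin> G'\<^sup>+" for a b
  proof -
    have ab': "a \<in> U" "b \<in> U" "a \<noteq> b" using ab U xyz by (auto simp: doubleton_eq_iff)
    have "(y, x) \<in> G' \<or> (y, z) \<in> G'"
      using not_v nonadj adj xyz(3) by (auto simp: v_structure_def)
    \<comment> \<open>Otherwise \<open>a \<rightarrow> y\<close> and
      \<open>y \<rightarrow> b\<close> would make \<open>b\<close> a descendant of \<open>a\<close>.
      The edge \<open>y \<rightarrow> a\<close> in turn keeps \<open>y\<close> from being a
      descendant of \<open>a\<close>.\<close>
    then have ya: "(y, a) \<in> G'"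
      using ab nanc adj by (auto simp: doubleton_eq_iff intro: trancl_into_trancl)
    then have nay: "(a, y) \<notin> G'\<^sup>+"
      using dag_trancl_irrefl[OF G', of a] by (meson trancl.trancl_into_trancl)
    have "a \<noteq> y" using ab ne by (auto simp: doubleton_eq_iff)
    have "\<forall>p\<in>parents G' a. s p = t p"
      using nonadj ab parents_subset[OF G', of a] dag_trancl_irrefl[OF G', of a]
      by (auto simp: s_def t_def parents_def doubleton_eq_iff)
    from represents_support_exchange[OF \<open>finite U\<close> G rep(1) S \<open>a \<in> U\<close> s t this]
    obtain w where w: "\<forall>v\<in>U. w v \<in> S v (restrict w (parents G v))"
      "w a = s a" "w b = t b" "w y = t y"
      using nanc nay ab' \<open>a \<noteq> y\<close> U(2) by metis
    have "w a = 1" "w b = 0" "w y = 0"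
      using w(2-4) ab U by (auto simp: s_def t_def doubleton_eq_iff)
    moreover have "w y = (if w x = w z then 0 else 1)"
      using bspec[OF w(1) U(2)] ne p by (simp add: S_def)
    ultimately show False using ab by (auto simp: doubleton_eq_iff)
  qed
  from this[of x z] this[of z x] have "(x, z) \<in> G'\<^sup>+" "(z, x) \<in> G'\<^sup>+" by auto
  with dag_trancl_irrefl[OF G'] show False by (meson trancl_trans)
qed

section \<open>Covered edge reversal\<close>

lemma equivalent_sym: "equivalent U r G G' \<Longrightarrow> equivalent U r G' G"
  by (simp add: equivalent_def)

lemma represents_trans:
  assumes "represents U r G1 G2" "represents U r G2 G3"
  shows "represents U r G1 G3"
  unfolding represents_def using assms by (metis represents_def)

lemma equivalent_trans:
  "equivalent U r G1 G2 \<Longrightarrow> equivalent U r G2 G3 \<Longrightarrow> equivalent U r G1 G3"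
  unfolding equivalent_def using represents_trans by blast

text \<open>A new cycle needs a second path from \<open>x\<close> to \<open>y\<close>. Its last node
  \<open>w\<close> before \<open>y\<close> is a parent of \<open>y\<close> other than
  \<open>x\<close>, hence a parent of \<open>x\<close>, and the path already closes a cycle in
  \<open>G\<close>.\<close>

lemma dag_reverse_covered:
  assumes G: "dag U G" and cov: "covered G (x, y)"
  shows "dag U (reverse_edge (x, y) G)"
proof -
  have xy: "(x, y) \<in> G" and par: "parents G y = parents G x \<union> {x}"
    using cov by (auto simp: covered_def)
  have "x \<noteq> y" using xy dag_trancl_irrefl[OF G] by blast
  have "(x, y) \<notin> (G - {(x, y)})\<^sup>*"
  proof
    assume "(x, y) \<in> (G - {(x, y)})\<^sup>*"
    with \<open>x \<noteq> y\<close> obtain w where w: "(x, w) \<in> (G - {(x, y)})\<^sup>*" "(w, y) \<in> G" "w \<noteq> x"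
      by (metis DiffE rtranclE singletonI)
    then have "(w, x) \<in> G" using par by (auto simp: parents_def)
    moreover have "(x, w) \<in> G\<^sup>*" using w(1) rtrancl_mono[of "G - {(x, y)}" G] by blast
    ultimately show False using dag_trancl_irrefl[OF G] by (meson rtrancl_into_trancl1)
  qed
  moreover have "acyclic (G - {(x, y)})"
    using G by (meson Diff_subset acyclic_subset dag_def)
  ultimately show ?thesis
    using G xy by (auto simp: dag_def reverse_edge_def acyclic_insert)
qed

lemma parents_reverse_covered:
  assumes "dag U G" "covered G (x, y)"
  shows "parents (reverse_edge (x, y) G) y = parents G x"
    "parents (reverse_edge (x, y) G) x = insert y (parents G x)"
    "v \<noteq> x \<Longrightarrow> v \<noteq> y \<Longrightarrow> parents (reverse_edge (x, y) G) v = parents G v"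
    "x \<notin> parents G x" "y \<notin> parents G x" "x \<noteq> y"
proof -
  have xy: "(x, y) \<in> G" and par: "\<And>u. (u, y) \<in> G \<longleftrightarrow> (u, x) \<in> G \<or> u = x"
    using assms by (auto simp: covered_def parents_def)
  show *: "x \<notin> parents G x" "y \<notin> parents G x" "x \<noteq> y"
    using dag_trancl_irrefl[OF assms(1), of x] xy
    by (auto simp: parents_def intro: trancl_into_trancl)
  then show "parents (reverse_edge (x, y) G) y = parents G x"
    "parents (reverse_edge (x, y) G) x = insert y (parents G x)"
    "v \<noteq> x \<Longrightarrow> v \<noteq> y \<Longrightarrow> parents (reverse_edge (x, y) G) v = parents G v"
    using par by (auto simp: parents_def reverse_edge_def)
qed

lemma covered_reverse:
  assumes "dag U G" "covered G (x, y)"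
  shows "covered (reverse_edge (x, y) G) (y, x)"
  using parents_reverse_covered[OF assms] by (auto simp: covered_def reverse_edge_def)

lemma reverse_reverse_covered:
  assumes "dag U G" "covered G (x, y)"
  shows "reverse_edge (y, x) (reverse_edge (x, y) G) = G"
proof -
  have "(x, y) \<in> G" using assms(2) by (simp add: covered_def)
  moreover have "(y, x) \<notin> G"
    using parents_reverse_covered(5)[OF assms] by (simp add: parents_def)
  ultimately show ?thesis by (auto simp: reverse_edge_def)
qed

text \<open>With \<open>P\<close> the parents of \<open>x\<close>, the two factors at
  \<open>x\<close> and \<open>y\<close> form the joint distribution of this pair given
  \<open>P\<close>. It can be factored in the other order, and all other nodes keep their parents
  and their distributions.\<close>

lemma represents_reverse_covered:
  assumes "finite U" and r: "\<forall>x\<in>U. r x \<ge> 2"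
    and G: "dag U G" and cov: "covered G (x, y)"
  shows "represents U r (reverse_edge (x, y) G) G"
  unfolding represents_def
proof (intro allI impI)
  fix \<theta> assume \<theta>: "bayesian_network U r G \<theta>"
  define G1 where "G1 = reverse_edge (x, y) G"
  define P where "P = parents G x"
  have U: "x \<in> U" "y \<in> U" using G cov by (auto simp: dag_def covered_def)
  have PU: "P \<subseteq> U" using parents_subset[OF G] by (simp add: P_def)
  have Py: "parents G y = insert x P" using cov by (auto simp: covered_def P_def)
  note par = parents_reverse_covered[OF G cov, folded G1_def P_def]
  \<comment> \<open>\<open>q c j k\<close> is the probability of \<open>x = j\<close> and
    \<open>y = k\<close> given that \<open>P\<close> is in state \<open>c\<close>; summing out
    \<open>x\<close> gives the marginal \<open>m\<close> of \<open>y\<close>.\<close>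
  define q where "q = (\<lambda>c j k. \<theta> x c j * \<theta> y (c(x := j)) k)"
  define m where "m = (\<lambda>c k. \<Sum>j<r x. q c j k)"
  \<comment> \<open>Bayes' rule; where the marginal \<open>m\<close> vanishes any distribution of \<open>x\<close> will do.\<close>
  define \<theta>' where "\<theta>' = (\<lambda>v. if v = y then m
    else if v = x then (\<lambda>c j. let d = restrict c P in
      if m d (c y) = 0 then (if j = 0 then 1 else 0) else q d j (c y) / m d (c y))
    else \<theta> v)"
  have upd: "c(x := j) \<in> configs r (insert x P)" if "c \<in> configs r P" "j < r x" for c j
    using that by (auto simp: configs_def PiE_def extensional_def)
  have \<theta>x: "0 \<le> \<theta> x c j" if "c \<in> configs r P" "j < r x" for c j
    using \<theta> U that by (simp add: bayesian_network_def P_def)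
  have sx: "(\<Sum>j<r x. \<theta> x c j) = 1" if "c \<in> configs r P" for c
    using \<theta> U that by (simp add: bayesian_network_def P_def)
  have \<theta>y: "0 \<le> \<theta> y c k" if "c \<in> configs r (insert x P)" "k < r y" for c k
    using \<theta> U that Py by (simp add: bayesian_network_def)
  have sy: "(\<Sum>k<r y. \<theta> y c k) = 1" if "c \<in> configs r (insert x P)" for c
    using \<theta> U that Py by (simp add: bayesian_network_def)
  have q0: "0 \<le> q c j k" if "c \<in> configs r P" "j < r x" "k < r y" for c j k
    using \<theta>x \<theta>y upd that by (simp add: q_def)
  have m0: "0 \<le> m c k" if "c \<in> configs r P" "k < r y" for c k
    using q0 that by (auto simp: m_def intro!: sum_nonneg)
  have m1: "(\<Sum>k<r y. m c k) = 1" if c: "c \<in> configs r P" for c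
  proof -
    have "(\<Sum>k<r y. m c k) = (\<Sum>j<r x. \<theta> x c j * (\<Sum>k<r y. \<theta> y (c(x := j)) k))"
      unfolding m_def q_def by (subst sum.swap) (simp add: sum_distrib_left)
    also have "\<dots> = (\<Sum>j<r x. \<theta> x c j)" using sy upd[OF c] by simp
    finally show ?thesis using sx[OF c] by simp
  qed
  have bn: "bayesian_network U r G1 \<theta>'"
    unfolding bayesian_network_def
  proof (intro conjI ballI)
    show "dag U G1" unfolding G1_def by (rule dag_reverse_covered[OF G cov])
    fix v c assume v: "v \<in> U" and c: "c \<in> configs r (parents G1 v)"
    consider "v = y" | "v = x" | "v \<noteq> x" "v \<noteq> y" by blast
    then have "(\<forall>k<r v. 0 \<le> \<theta>' v c k) \<and> (\<Sum>k<r v. \<theta>' v c k) = 1"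
    proof cases
      case 1
      with c m0 m1 par(1) show ?thesis by (simp add: \<theta>'_def)
    next
      case 2
      define d where "d = restrict c P"
      have c': "c \<in> configs r (insert y P)" using c 2 par(2) by simp
      have d: "d \<in> configs r P" and cy: "c y < r y"
        using restrict_configs[OF c'] configs_less[OF c'] by (auto simp: d_def)
      have \<theta>': "\<theta>' v c j = (if m d (c y) = 0 then (if j = 0 then 1 else 0)
          else q d j (c y) / m d (c y))" for j
        using 2 par(6) by (simp add: \<theta>'_def d_def Let_def)
      show ?thesis
      proof (cases "m d (c y) = 0")
        case True
        \<comment> \<open>The point mass at 0 is a distribution because \<open>r v \<ge> 2\<close>
          makes 0 one of the states.\<close>
        with bspec[OF r v] show ?thesis by (simp add: \<theta>')
      next
        case False
        then have "(\<Sum>k<r v. \<theta>' v c k) = 1"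
          unfolding \<theta>' using 2 by (simp add: m_def flip: sum_divide_distrib)
        moreover have "\<forall>k<r v. 0 \<le> \<theta>' v c k"
          unfolding \<theta>' using False q0[OF d _ cy] m0[OF d cy] 2 by simp
        ultimately show ?thesis by blast
      qed
    next
      case 3
      with c v \<theta> par(3) show ?thesis by (simp add: \<theta>'_def bayesian_network_def)
    qed
    then show "\<forall>k<r v. 0 \<le> \<theta>' v c k" "(\<Sum>k<r v. \<theta>' v c k) = 1" by auto
  qed
  have "joint U G1 \<theta>' s = joint U G \<theta> s" if s: "s \<in> configs r U" for s
  proof -
    define d where "d = restrict s P"
    have d: "d \<in> configs r P" using restrict_configs[OF s PU] by (simp add: d_def)
    have lt: "s x < r x" "s y < r y" using configs_less[OF s] U by auto
    have split: "(\<Prod>v\<in>U. f v) = f x * f y * (\<Prod>v\<in>U - {x, y}. f v)" for f :: "'a \<Rightarrow> real"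
      using \<open>finite U\<close> U par(6) prod.subset_diff[of "{x, y}" U f] by (simp add: mult.commute)
    have "restrict s (insert x P) = d(x := s x)"
      by (auto simp: d_def restrict_def fun_eq_iff)
    then have old: "\<theta> x (restrict s (parents G x)) (s x) * \<theta> y (restrict s (parents G y)) (s y)
        = q d (s x) (s y)"
      by (simp add: q_def Py flip: P_def d_def)
    have "restrict (restrict s (insert y P)) P = d"
      by (auto simp: d_def restrict_def fun_eq_iff)
    then have new: "\<theta>' x (restrict s (parents G1 x)) (s x) * \<theta>' y (restrict s (parents G1 y)) (s y)
        = (if m d (s y) = 0 then (if s x = 0 then 1 else 0)
            else q d (s x) (s y) / m d (s y)) * m d (s y)"
      using par(6) by (simp add: \<theta>'_def par(1,2) Let_def flip: d_def)
    \<comment> \<open>A vanishing sum of nonnegative terms has vanishing terms, so both products are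
      0 where the division is undefined in Bayes' rule.\<close>
    have "q d (s x) (s y) = 0" if "m d (s y) = 0"
      using that q0[OF d _ lt(2)] lt(1) unfolding m_def by (subst (asm) sum_nonneg_eq_0_iff) auto
    with new old have xy: "\<theta>' x (restrict s (parents G1 x)) (s x) * \<theta>' y (restrict s (parents G1 y)) (s y)
        = \<theta> x (restrict s (parents G x)) (s x) * \<theta> y (restrict s (parents G y)) (s y)"
      by auto
    have "(\<Prod>v\<in>U - {x, y}. \<theta>' v (restrict s (parents G1 v)) (s v))
        = (\<Prod>v\<in>U - {x, y}. \<theta> v (restrict s (parents G v)) (s v))"
      by (rule prod.cong) (auto simp: par(3) \<theta>'_def)
    with xy show ?thesis unfolding joint_def split by simp
  qed
  with bn show "\<exists>\<theta>'. bayesian_network U r (reverse_edge (x, y) G) \<theta>' \<and>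
      (\<forall>s\<in>configs r U. joint U (reverse_edge (x, y) G) \<theta>' s = joint U G \<theta> s)"
    unfolding G1_def by blast
qed

text \<open>The converse direction comes from reversing the edge back, which is again the reversal
  of a covered edge and restores \<open>G\<close>.\<close>

lemma equivalent_reverse_covered:
  assumes "finite U" and "\<forall>x\<in>U. r x \<ge> 2"
    and "dag U G" and "covered G (x, y)"
  shows "equivalent U r (reverse_edge (x, y) G) G"
  using represents_reverse_covered[OF assms]
    represents_reverse_covered[OF assms(1,2) dag_reverse_covered[OF assms(3,4)]
      covered_reverse[OF assms(3,4)]]
  by (simp add: equivalent_def reverse_reverse_covered[OF assms(3,4)])

section \<open>Finding a covered edge\<close>

lemma covered_edge_in_Delta:
  assumes "finite U" and G: "dag U G" and G': "dag U G'"
    and skel: "\<And>x y. (x, y) \<in> G \<or> (y, x) \<in> G \<longleftrightarrow> (x, y) \<in> G' \<or> (y, x) \<in> G'"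
    and vstr: "\<And>x y z. v_structure G x y z \<longleftrightarrow> v_structure G' x y z"
    and "Delta G G' \<noteq> {}"
  shows "\<exists>x y. (x, y) \<in> Delta G G' \<and> covered G (x, y)"
proof -
  have asym: "(b, a) \<notin> H" "a \<noteq> b" if "dag U H" "(a, b) \<in> H" for a b H
    using dag_trancl_irrefl[OF that(1), of a] that(2) by (auto intro: trancl_into_trancl)
  have shortcut: "(c, a) \<notin> H" if "dag U H" "(a, b) \<in> H" "(b, c) \<in> H" for a b c H
    using dag_trancl_irrefl[OF that(1), of a] that(2,3) by (meson r_into_trancl' trancl_into_trancl)
  from \<open>Delta G G' \<noteq> {}\<close> obtain y0 where "y0 \<in> snd ` Delta G G'" by blast
  with wfE_min[OF dag_wf[OF \<open>finite U\<close> G]]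
  obtain y where "y \<in> snd ` Delta G G'"
    and ymin': "\<And>v. (v, y) \<in> G\<^sup>+ \<Longrightarrow> v \<notin> snd ` Delta G G'"
    by metis
  then obtain x0 where "x0 \<in> {x. (x, y) \<in> Delta G G'}" by force
  with wfE_min[OF dag_wf_converse[OF \<open>finite U\<close> G]]
  obtain x where x: "(x, y) \<in> Delta G G'"
    and xmax: "\<And>w. (x, w) \<in> G \<Longrightarrow> (w, y) \<notin> Delta G G'"
    by (metis (mono_tags, lifting) converseI mem_Collect_eq r_into_trancl')
  have ymin: "(u, v) \<notin> Delta G G'" if "(v, y) \<in> G" for u v
    using ymin'[of v] that by force
  have xy: "(x, y) \<in> G" "(y, x) \<in> G'" using x by (auto simp: Delta_def)
  \<comment> \<open>Minimality of \<open>y\<close> keeps \<open>w \<rightarrow> x\<close> in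
    \<open>G'\<close>. If \<open>w\<close> and \<open>y\<close> were nonadjacent,
    \<open>w \<rightarrow> x\<close> and \<open>y \<rightarrow> x\<close> would form a v-structure
    of \<open>G'\<close> that \<open>G\<close> lacks.\<close>
  have "(w, y) \<in> G" if wx: "(w, x) \<in> G" for w
  proof (rule ccontr)
    assume "(w, y) \<notin> G"
    with shortcut[OF G wx xy(1)] have nonadj: "(w, y) \<notin> G'" "(y, w) \<notin> G'"
      using skel by blast+
    have "(w, x) \<in> G'" using ymin[OF xy(1), of w] wx skel by (auto simp: Delta_def)
    moreover have "w \<noteq> y" using asym(1)[OF G wx] xy(1) by blast
    ultimately have "v_structure G' w x y" using nonadj xy by (simp add: v_structure_def)
    then have "(y, x) \<in> G" using vstr by (metis v_structure_def)
    with asym(1)[OF G xy(1)] show False by simp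
  qed
  \<comment> \<open>If \<open>w\<close> and \<open>x\<close> are nonadjacent, the v-structure at
    \<open>y\<close> forces \<open>x \<rightarrow> y\<close> in \<open>G'\<close>. If
    \<open>x \<rightarrow> w\<close>, maximality of \<open>x\<close> keeps
    \<open>w \<rightarrow> y\<close>, so acyclicity of \<open>G'\<close> turns
    \<open>x \<rightarrow> w\<close> around; then \<open>w\<close> is the head of a reversed edge
    and precedes \<open>y\<close>.\<close>
  moreover have "(w, x) \<in> G" if wy: "(w, y) \<in> G" and "w \<noteq> x" for w
  proof (rule ccontr)
    assume nwx: "(w, x) \<notin> G"
    show False
    proof (cases "(x, w) \<in> G")
      case False
      with nwx wy xy \<open>w \<noteq> x\<close> have "v_structure G w y x" by (simp add: v_structure_def)
      then have "(x, y) \<in> G'" using vstr by (metis v_structure_def)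
      with asym(1)[OF G' xy(2)] show False by simp
    next
      case True
      from xmax[OF True] have "(w, y) \<in> G'" using wy skel by (auto simp: Delta_def)
      with shortcut[OF G' _ xy(2)] have "(w, x) \<in> G'" using True skel by blast
      with True ymin[OF wy, of x] show False by (simp add: Delta_def)
    qed
  qed
  ultimately have "covered G (x, y)" using xy by (auto simp: covered_def parents_def)
  with x show ?thesis by blast
qed

section \<open>Induction on the number of oppositely oriented edges\<close>

lemma Delta_reverse_edge:
  assumes "dag U G" "dag U G'" "(x, y) \<in> Delta G G'"
  shows "Delta (reverse_edge (x, y) G) G' = Delta G G' - {(x, y)}"
proof -
  have "(x, y) \<in> G" "(y, x) \<in> G'" using assms(3) by (auto simp: Delta_def)
  moreover have "(y, x) \<notin> G" "(x, y) \<notin> G'"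
    using calculation dag_trancl_irrefl[OF assms(1), of x] dag_trancl_irrefl[OF assms(2), of x]
    by (auto intro: trancl_into_trancl)
  ultimately show ?thesis by (auto simp: Delta_def reverse_edge_def)
qed

lemma after_reversals_0 [simp]: "after_reversals es 0 G = G"
  by (simp add: after_reversals_def)

lemma after_reversals_Cons_Suc [simp]:
  "after_reversals (e # es) (Suc i) G = after_reversals es i (reverse_edge e G)"
  by (simp add: after_reversals_def)

text \<open>The clause \<open>set es \<subseteq> Delta G G'\<close> strengthens the induction
  hypothesis: it confines the later reversals to the remaining differences, which yields
  distinctness.\<close>

lemma covered_reversal_sequence:
  assumes "finite U" and r: "\<forall>x\<in>U. r x \<ge> 2"
    and "dag U G" and G': "dag U G'" and "equivalent U r G G'"
  shows "\<exists>es. length es = card (Delta G G') \<and> set es \<subseteq> Delta G G' \<and> distinct_edges es \<and>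
    (\<forall>i<length es. covered (after_reversals es i G) (es ! i)) \<and>
    (\<forall>i<length es. dag U (after_reversals es (Suc i) G) \<and>
       equivalent U r (after_reversals es (Suc i) G) G') \<and>
    after_reversals es (length es) G = G'"
  using assms(3,5)
proof (induction "card (Delta G G')" arbitrary: G)
  have fin: "finite (Delta G G')" if "dag U G" for G
    using dag_finite[OF \<open>finite U\<close> that] by (rule rev_finite_subset) (auto simp: Delta_def)
  have skel: "(x, y) \<in> G \<or> (y, x) \<in> G \<longleftrightarrow> (x, y) \<in> G' \<or> (y, x) \<in> G'"
    if "dag U G" "equivalent U r G G'" for G x y
    using represents_adjacent[OF \<open>finite U\<close> r] that G' unfolding equivalent_def by metis
  {
    case 0
    then have "Delta G G' = {}" using fin by simp
    \<comment> \<open>Equal skeletons with no edge oriented oppositely leave only equal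
      graphs.\<close>
    with skel[OF "0.prems"] have "G = G'" by (auto simp: Delta_def)
    with \<open>Delta G G' = {}\<close> show ?case by (auto simp: distinct_edges_def)
  next
    case (Suc n)
    have "Delta G G' \<noteq> {}" using Suc.hyps(2) by auto
    moreover have "v_structure G x y z \<longleftrightarrow> v_structure G' x y z" for x y z
      using represents_v_structure[OF \<open>finite U\<close> r] Suc.prems G' equivalent_sym by metis
    ultimately obtain x y where xy: "(x, y) \<in> Delta G G'" and cov: "covered G (x, y)"
      using covered_edge_in_Delta[OF \<open>finite U\<close> Suc.prems(1) G' skel[OF Suc.prems]] by blast
    define G1 where "G1 = reverse_edge (x, y) G"
    have dag1: "dag U G1" unfolding G1_def by (rule dag_reverse_covered[OF Suc.prems(1) cov])
    have eq1: "equivalent U r G1 G'" unfolding G1_def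
      by (rule equivalent_trans[OF equivalent_reverse_covered[OF \<open>finite U\<close> r Suc.prems(1) cov] Suc.prems(2)])
    have D1: "Delta G1 G' = Delta G G' - {(x, y)}"
      unfolding G1_def by (rule Delta_reverse_edge[OF Suc.prems(1) G' xy])
    then have "n = card (Delta G1 G')" using Suc.hyps(2) xy fin[OF Suc.prems(1)] by simp
    from Suc.hyps(1)[OF this dag1 eq1] obtain es where es:
      "length es = card (Delta G1 G')" "set es \<subseteq> Delta G1 G'" "distinct_edges es"
      "\<forall>i<length es. covered (after_reversals es i G1) (es ! i)"
      "\<forall>i<length es. dag U (after_reversals es (Suc i) G1) \<and>
         equivalent U r (after_reversals es (Suc i) G1) G'"
      "after_reversals es (length es) G1 = G'" by blast
    \<comment> \<open>Distinctness ignores orientation, so the opposite edge must be excluded from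
      the later reversals too; \<open>D1\<close> only removes \<open>(x, y)\<close>.\<close>
    have "(y, x) \<notin> Delta G G'"
      using xy dag_trancl_irrefl[OF Suc.prems(1), of x]
      by (auto simp: Delta_def intro: trancl_into_trancl)
    with es(2) D1 have "{x, y} \<notin> set (map (\<lambda>(x, y). {x, y}) es)"
      by (auto simp: doubleton_eq_iff)
    with es(3) have "distinct_edges ((x, y) # es)" by (simp add: distinct_edges_def)
    moreover have "length ((x, y) # es) = card (Delta G G')"
      using es(1) \<open>n = card (Delta G1 G')\<close> Suc.hyps(2) by simp
    moreover have "set ((x, y) # es) \<subseteq> Delta G G'" using es(2) D1 xy by auto
    moreover have "covered (after_reversals ((x, y) # es) i G) (((x, y) # es) ! i)"
      if "i < length ((x, y) # es)" for i
      using that es(4) cov by (cases i) (auto simp flip: G1_def)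
    moreover have "dag U (after_reversals ((x, y) # es) (Suc i) G) \<and>
        equivalent U r (after_reversals ((x, y) # es) (Suc i) G) G'"
      if "i < length ((x, y) # es)" for i
      using that es(5) dag1 eq1 by (cases i) (auto simp flip: G1_def)
    moreover have "after_reversals ((x, y) # es) (length ((x, y) # es)) G = G'"
      using es(6) by (simp flip: G1_def)
    ultimately show ?case by blast
  }
qed

theorem theorem2:
  fixes U :: "'a set" and r :: "'a \<Rightarrow> nat" and G G' :: "('a \<times> 'a) set"
  assumes "finite U"
    and "\<And>x. x \<in> U \<Longrightarrow> r x \<ge> 2"
    and "dag U G" and "dag U G'"
    and "equivalent U r G G'"
  shows "\<exists>es. length es = card (Delta G G') \<and> distinct_edges es \<and>
    (\<forall>i<length es. covered (after_reversals es i G) (es ! i)) \<and>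
    (\<forall>i<length es. dag U (after_reversals es (Suc i) G) \<and>
       equivalent U r (after_reversals es (Suc i) G) G') \<and>
    after_reversals es (length es) G = G'"
  using covered_reversal_sequence[OF assms(1) _ assms(3-5)] assms(2) by blast

end
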